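(* For every integer $n\ge 2$, the number of $1$-flaw preference sets $(a_1,\dots,a_n)$ with $n$ spaces and $a_1=n$ equals the number of parking functions $(a_1,\dots,a_n)$ with $n$ spaces and $a_1=2$; in the paper's notation, $p^n_{n;1}=p^2_n$.
   Context: Parking model: there are $n$ parking spaces in a line, numbered $1,\dots,n$. A preference set of length $n$ is a sequence $(a_1,\dots,a_n)$ of integers with $1\le a_i\le n$; cars $1,\dots,n$ arrive in order, car $i$ parks in the first unoccupied space numbered $\ge a_i$ if one exists, otherwise it fails to park. It is a $k$-flaw preference set if exactly $k$ cars fail to park, and a parking function if no car fails. $p^l_{n;k}$ denotes the number of $k$-flaw preference sets of length $n$ (with $n$ spaces) with $a_1=l$, and $p^l_n$ the number of parking functions of length $n$ (with $n$ spaces) with $a_1=l$. *)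

theory Defs imports Main
begin

definition preference_sets :: "nat \<Rightarrow> nat list set" where
  "preference_sets n = {a. length a = n \<and> set a \<subseteq> {1..n}}"

text \<open>\<open>failures n occ as\<close> is the number of cars that fail to park when cars with preferences
  \<open>as\<close> arrive in this order at spaces \<open>1, \<dots>, n\<close>, of which those in \<open>occ\<close> are already occupied.\<close>

fun failures :: "nat \<Rightarrow> nat set \<Rightarrow> nat list \<Rightarrow> nat" where
  "failures n occ [] = 0"
| "failures n occ (a # as) =
     (let free = {s \<in> {1..n}. a \<le> s \<and> s \<notin> occ}
      in if free = {} then Suc (failures n occ as)
         else failures n (insert (Min free) occ) as)"

definition flaw_preference_sets :: "nat \<Rightarrow> nat \<Rightarrow> nat list set" where
  "flaw_preference_sets n k = {a \<in> preference_sets n. failures n {} a = k}"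

definition parking_functions :: "nat \<Rightarrow> nat list set" where
  "parking_functions n = {a \<in> preference_sets n. failures n {} a = 0}"

definition num_flaw_pref :: "nat \<Rightarrow> nat \<Rightarrow> nat \<Rightarrow> nat" where
  "num_flaw_pref n k l = card {a \<in> flaw_preference_sets n k. hd a = l}"

definition num_parking :: "nat \<Rightarrow> nat \<Rightarrow> nat" where
  "num_parking n l = card {a \<in> parking_functions n. hd a = l}"

end

theory Submission imports Defs
begin

text \<open>
  At most \<open>k\<close> cars fail iff for every \<open>i\<close> the number of preferences \<open>\<ge> i\<close> exceeds the number of
  free spaces \<open>\<ge> i\<close> by at most \<open>k\<close>. Drop the prescribed first preference. Among the preference
  lists \<open>b\<close> of length \<open>n - 1\<close>, let \<open>A\<close> consist of those for which \<open>1 # b\<close> is a parking function,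
  and \<open>B\<close> of those that are themselves parking functions of length \<open>n - 1\<close>. Then
  \<open>n # b\<close> has exactly one flaw iff \<open>b \<in> A - B\<close>, while \<open>2 # b\<close> is a parking function iff
  \<open>b \<in> A\<close> contains a \<open>1\<close>. The elements of \<open>A\<close> without a \<open>1\<close> are the elements of \<open>B\<close>
  with every entry raised by one, so both sides equal \<open>|A| - |B|\<close>.
\<close>

definition count_ge :: "nat \<Rightarrow> nat list \<Rightarrow> nat" where
  "count_ge i xs = length (filter (\<lambda>x. i \<le> x) xs)"

lemma count_ge_Nil [simp]: "count_ge i [] = 0"
  by (simp add: count_ge_def)

lemma count_ge_Cons [simp]:
  "count_ge i (x # xs) = (if i \<le> x then Suc (count_ge i xs) else count_ge i xs)"
  by (simp add: count_ge_def)

lemma count_ge_antimono: "i \<le> j \<Longrightarrow> count_ge j xs \<le> count_ge i xs"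
  by (induction xs) auto

lemma count_ge_le_length: "count_ge i xs \<le> length xs"
  by (simp add: count_ge_def)

lemma count_ge_eq_length_iff: "count_ge i xs = length xs \<longleftrightarrow> (\<forall>x\<in>set xs. i \<le> x)"
proof (induction xs)
  case (Cons x xs)
  then show ?case using count_ge_le_length[of i xs] by auto
qed simp

lemma count_ge_eq_0_iff: "count_ge i xs = 0 \<longleftrightarrow> (\<forall>x\<in>set xs. x < i)"
  by (induction xs) auto

lemma count_ge_map_Suc: "count_ge (Suc i) (map Suc xs) = count_ge i xs"
  by (induction xs) auto

text \<open>Induction over the cars. A car that fails uses up one unit of \<open>k\<close>. A car
  that parks takes the least free space \<open>m \<ge> a\<close>: for \<open>i \<le> a\<close> both
  counts drop by one, for \<open>i > m\<close> neither changes, and for \<open>a < i \<le> m\<close>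
  the bound at \<open>a\<close> takes over.\<close>

lemma failures_le_iff:
  "failures n occ as \<le> k \<longleftrightarrow>
     (\<forall>i. count_ge i as \<le> card {s \<in> {1..n}. i \<le> s \<and> s \<notin> occ} + k)"
proof (induction as arbitrary: occ k)
  case Nil
  then show ?case by simp
next
  case (Cons a as)
  define F where "F = (\<lambda>occ i. {s \<in> {1..n}. i \<le> s \<and> s \<notin> occ})"
  have finF: "finite (F occ i)" for occ i
    by (simp add: F_def)
  have IH: "failures n occ as \<le> k \<longleftrightarrow> (\<forall>i. count_ge i as \<le> card (F occ i) + k)" for occ k
    using Cons.IH by (simp add: F_def)
  have mono: "count_ge i as \<le> count_ge a as" if "a \<le> i" for i
    using count_ge_antimono that by blast
  have "failures n occ (a # as) \<le> k \<longleftrightarrow> (\<forall>i. count_ge i (a # as) \<le> card (F occ i) + k)"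
  proof (cases "F occ a = {}")
    case True
    then have step: "failures n occ (a # as) = Suc (failures n occ as)"
      by (simp add: F_def Let_def)
    have empty: "F occ i = {}" if "a \<le> i" for i
      using True that by (auto simp: F_def)
    show ?thesis
    proof
      assume "failures n occ (a # as) \<le> k"
      then obtain k' where k': "k = Suc k'" "failures n occ as \<le> k'"
        using step by (cases k) auto
      then have "count_ge i as \<le> card (F occ i) + k'" for i
        using IH by blast
      then show "\<forall>i. count_ge i (a # as) \<le> card (F occ i) + k"
        using k' by (auto simp: le_SucI)
    next
      assume R: "\<forall>i. count_ge i (a # as) \<le> card (F occ i) + k"
      \<comment> \<open>No space from \<open>a\<close> on is free, so the bound at \<open>a\<close>
        forces \<open>k\<close> to be positive and, by monotonicity, also settles every
        \<open>i > a\<close>.\<close>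
      have a: "Suc (count_ge a as) \<le> k"
        using R[rule_format, of a] True by simp
      then obtain k' where k': "k = Suc k'" by (cases k) auto
      have "count_ge i as \<le> card (F occ i) + k'" for i
        using R[rule_format, of i] a mono[of i] k' by (cases "i \<le> a") auto
      then show "failures n occ (a # as) \<le> k"
        using IH step k' by simp
    qed
  next
    case False
    define m where "m = Min (F occ a)"
    have m: "m \<in> F occ a" and least: "\<And>s. s \<in> F occ a \<Longrightarrow> m \<le> s"
      using False finF by (auto simp: m_def)
    have am: "a \<le> m" using m by (simp add: F_def)
    have step: "failures n occ (a # as) = failures n (insert m occ) as"
      using False unfolding F_def m_def failures.simps Let_def by (simp only: if_False)
    have card_insert: "card (F occ i) = (if i \<le> m then Suc (card (F (insert m occ) i))
        else card (F (insert m occ) i))" for i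
    proof (cases "i \<le> m")
      case True
      then have "F occ i = insert m (F (insert m occ) i)" "m \<notin> F (insert m occ) i"
        using m by (auto simp: F_def)
      then show ?thesis using True finF by simp
    next
      case False
      then have "F occ i = F (insert m occ) i" by (auto simp: F_def)
      then show ?thesis using False by simp
    qed
    \<comment> \<open>No space from \<open>a\<close> up to \<open>m - 1\<close> is free.\<close>
    have same: "F occ i = F occ a" if "a \<le> i" "i \<le> m" for i
      using that least by (fastforce simp: F_def)
    show ?thesis
      unfolding step IH
    proof (intro iffI allI)
      fix i assume "\<forall>i. count_ge i as \<le> card (F (insert m occ) i) + k"
      then show "count_ge i (a # as) \<le> card (F occ i) + k"
        using am by (simp add: card_insert le_SucI)
    next
      fix i assume R: "\<forall>i. count_ge i (a # as) \<le> card (F occ i) + k"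
      consider "i \<le> a" | "a < i" "i \<le> m" | "m < i" by linarith
      then show "count_ge i as \<le> card (F (insert m occ) i) + k"
      proof cases
        case 1
        then show ?thesis using R[rule_format, of i] am card_insert[of i] by simp
      next
        \<comment> \<open>Only the number of free spaces drops here. The bound at \<open>a\<close>
          makes up for it, as it counts the current car and refers to the same free spaces.\<close>
        case 2
        then show ?thesis
          using R[rule_format, of a] mono[of i] same[of i] card_insert[of i] by simp
      next
        case 3
        then show ?thesis using R[rule_format, of i] am card_insert[of i] by simp
      qed
    qed
  qed
  then show ?case by (simp only: F_def)
qed

text \<open>Thresholds outside \<open>{1..n}\<close> impose nothing: at 0 the bound follows from the
  length, and beyond \<open>n\<close> no preference is counted.\<close>

lemma failures_empty_le_iff:
  assumes "set as \<subseteq> {1..n}" "length as \<le> n"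
  shows "failures n {} as \<le> k \<longleftrightarrow> (\<forall>i\<in>{1..n}. count_ge i as \<le> Suc n - i + k)"
proof -
  have card: "card {s \<in> {1..n}. i \<le> s \<and> s \<notin> {}} = Suc n - i" if "i \<ge> 1" for i
  proof -
    have "{s \<in> {1..n}. i \<le> s \<and> s \<notin> {}} = {i..n}" using that by auto
    then show ?thesis by simp
  qed
  have "count_ge i as \<le> card {s \<in> {1..n}. i \<le> s \<and> s \<notin> {}} + k" if "i \<notin> {1..n}" for i
  proof (cases "i = 0")
    case True
    then have "{s \<in> {1..n}. i \<le> s \<and> s \<notin> {}} = {1..n}" by auto
    then show ?thesis using count_ge_le_length[of i as] assms(2) by simp
  next
    case False
    then have "count_ge i as = 0" using that assms(1) by (fastforce simp: count_ge_eq_0_iff)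
    then show ?thesis by simp
  qed
  then have "failures n {} as \<le> k \<longleftrightarrow>
      (\<forall>i\<in>{1..n}. count_ge i as \<le> card {s \<in> {1..n}. i \<le> s \<and> s \<notin> {}} + k)"
    unfolding failures_le_iff by blast
  then show ?thesis using card by simp
qed

text \<open>Prepending \<open>l\<close> is injective. Lists must be nonempty because
  \<open>hd []\<close> is unspecified.\<close>

lemma card_hd_eq:
  assumes "\<And>a. a \<in> X \<Longrightarrow> a \<noteq> []"
  shows "card {a \<in> X. hd a = l} = card {b. l # b \<in> X}"
proof -
  have "{a \<in> X. hd a = l} = (#) l ` {b. l # b \<in> X}"
    using assms by (force simp: image_iff neq_Nil_conv)
  then show ?thesis by (simp add: card_image)
qed

theorem theorem6p5:
  fixes n :: nat
  assumes "n \<ge> 2"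
  shows "num_flaw_pref n 1 n = num_parking n 2"
proof -
  define U where "U = {b::nat list. length b = n - 1 \<and> set b \<subseteq> {1..n}}"
  \<comment> \<open>At \<open>i = 1\<close> the bound is \<open>n\<close>, while \<open>b\<close>
    has only \<open>n - 1\<close> entries; this slack is why prepending 1 changes nothing.\<close>
  define A where "A = {b \<in> U. \<forall>i\<in>{1..n}. count_ge i b \<le> Suc n - i}"
  \<comment> \<open>The bound 0 at \<open>i = n\<close> excludes the entry \<open>n\<close>, which
    \<open>U\<close> still allows.\<close>
  define B where "B = {b \<in> U. \<forall>i\<in>{1..n}. count_ge i b \<le> n - i}"
  define C where "C = {b \<in> A. \<forall>x\<in>set b. 2 \<le> x}"

  have "finite U"
    using finite_lists_length_eq[of "{1..n}" "n - 1"] by (simp add: U_def conj_commute)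
  then have fin: "finite A" "finite B" by (auto simp: A_def B_def)
  have "B \<subseteq> A"
    unfolding A_def B_def by (auto intro: order_trans[OF _ diff_le_mono])
  have "C \<subseteq> A" by (auto simp: C_def)

  have pref: "l # b \<in> preference_sets n \<longleftrightarrow> b \<in> U" if "l \<in> {1..n}" for l b
    using that assms by (auto simp: preference_sets_def U_def)
  have le_iff: "failures n {} (l # b) \<le> k \<longleftrightarrow>
      (\<forall>i\<in>{1..n}. count_ge i (l # b) \<le> Suc n - i + k)" if "b \<in> U" "l \<in> {1..n}" for l b k
    using that by (intro failures_empty_le_iff) (auto simp: U_def)

  have "n # b \<in> flaw_preference_sets n 1 \<longleftrightarrow> b \<in> A - B" for b
  proof (cases "b \<in> U")
    case True
    \<comment> \<open>The first preference \<open>n\<close> raises the count at every threshold by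
      one. With \<open>k = 1\<close> this cancels the allowance; with \<open>k = 0\<close> it
      tightens \<open>Suc n - i\<close> to \<open>n - i\<close>.\<close>
    have "failures n {} (n # b) \<le> 1 \<longleftrightarrow> b \<in> A"
      using le_iff[OF True, of n 1] assms True by (auto simp: A_def simp del: failures.simps)
    moreover have "failures n {} (n # b) \<le> 0 \<longleftrightarrow> b \<in> B"
      using le_iff[OF True, of n 0] assms True by (auto simp: B_def Suc_diff_le simp del: failures.simps)
    ultimately have "failures n {} (n # b) = 1 \<longleftrightarrow> b \<in> A - B"
      by (auto simp del: failures.simps)
    then show ?thesis
      using pref[of n b] True assms by (simp add: flaw_preference_sets_def del: failures.simps)
  next
    case False
    then show ?thesis
      using pref[of n b] assms by (auto simp: flaw_preference_sets_def A_def)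
  qed
  then have "{b. n # b \<in> flaw_preference_sets n 1} = A - B" by blast
  moreover have "a \<noteq> []" if "a \<in> flaw_preference_sets n 1" for a
    using that assms by (auto simp: flaw_preference_sets_def preference_sets_def)
  ultimately have flaw: "num_flaw_pref n 1 n = card (A - B)"
    by (metis num_flaw_pref_def card_hd_eq)

  have "2 # b \<in> parking_functions n \<longleftrightarrow> b \<in> A - C" for b
  proof (cases "b \<in> U")
    case True
    then have len: "length b = n - 1" by (simp add: U_def)
    \<comment> \<open>Since \<open>b\<close> has \<open>n - 1\<close> entries, the count at 2
      exceeds \<open>n - 2\<close> only if it includes all of them.\<close>
    have full: "(\<forall>x\<in>set b. 2 \<le> x) \<longleftrightarrow> \<not> count_ge 2 b \<le> n - 2"
      using count_ge_eq_length_iff[of 2 b] count_ge_le_length[of 2 b] len assms by auto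
    \<comment> \<open>Prepending 2 raises the counts at 1 and 2 only. At 1 the length leaves room
      for it; at 2 the bound sharpens from \<open>n - 1\<close> to \<open>n - 2\<close>.\<close>
    have "failures n {} (2 # b) \<le> 0 \<longleftrightarrow>
        (\<forall>i\<in>{1..n}. count_ge i b \<le> Suc n - i) \<and> count_ge 2 b \<le> n - 2" (is "?L \<longleftrightarrow> ?R")
    proof
      assume ?L
      then have L: "\<forall>i\<in>{1..n}. count_ge i (2 # b) \<le> Suc n - i"
        using le_iff[OF True, of 2 0] assms by (simp del: failures.simps)
      have "count_ge i b \<le> Suc n - i" if "i \<in> {1..n}" for i
        using bspec[OF L that] by (simp split: if_splits)
      moreover have "count_ge 2 b \<le> n - 2" using bspec[OF L, of 2] assms by simp
      ultimately show ?R by blast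
    next
      assume R: ?R
      have "count_ge i (2 # b) \<le> Suc n - i" if i: "i \<in> {1..n}" for i
      proof -
        consider "i = 1" | "i = 2" | "i > 2" using i by fastforce
        then show ?thesis
        proof cases
          case 1
          then show ?thesis using count_ge_le_length[of 1 b] len assms by simp
        next
          case 2
          then show ?thesis using conjunct2[OF R] assms by simp
        next
          case 3
          then show ?thesis using R i by simp
        qed
      qed
      then show ?L using le_iff[OF True, of 2 0] assms by (simp del: failures.simps)
    qed
    then show ?thesis
      using pref[of 2 b] True assms full by (auto simp: parking_functions_def A_def C_def simp del: failures.simps)
  next
    case False
    then show ?thesis
      using pref[of 2 b] assms by (auto simp: parking_functions_def A_def)
  qed
  then have "{b. 2 # b \<in> parking_functions n} = A - C" by blast
  moreover have "a \<noteq> []" if "a \<in> parking_functions n" for a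
    using that assms by (auto simp: parking_functions_def preference_sets_def)
  ultimately have park: "num_parking n 2 = card (A - C)"
    by (metis num_parking_def card_hd_eq)

  have "C = map Suc ` B"
  proof (intro equalityI subsetI)
    fix c assume c: "c \<in> C"
    \<comment> \<open>Entries of \<open>c\<close> are at least 2, so subtracting 1 is undone by
      \<open>Suc\<close> and leaves entries that are at least 1.\<close>
    define b where "b = map (\<lambda>x. x - 1) c"
    have "map (Suc \<circ> (\<lambda>x. x - 1)) c = map id c"
      using c by (intro map_cong) (auto simp: C_def)
    then have cb: "c = map Suc b" by (simp add: b_def)
    have bU: "b \<in> U"
      using c by (fastforce simp: C_def A_def U_def b_def)
    have "count_ge i b \<le> n - i" if i: "i \<in> {1..n}" for i
    proof (cases "i = n")
      case True
      \<comment> \<open>The threshold \<open>n + 1\<close> for \<open>c\<close> lies outside the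
        range, so the bound on the entries of \<open>c\<close> replaces it.\<close>
      have "\<forall>x\<in>set b. x < n"
        using c cb by (auto simp: C_def A_def U_def)
      then show ?thesis using True by (simp add: count_ge_eq_0_iff)
    next
      case False
      then have "Suc i \<in> {1..n}" using i by simp
      then have "count_ge (Suc i) c \<le> Suc n - Suc i"
        using c unfolding C_def A_def by blast
      then show ?thesis by (simp add: cb count_ge_map_Suc)
    qed
    then show "c \<in> map Suc ` B" using bU cb by (auto simp: B_def)
  next
    fix c assume "c \<in> map Suc ` B"
    then obtain b where b: "b \<in> B" and cb: "c = map Suc b" by auto
    have bounds: "count_ge i b \<le> n - i" if "i \<in> {1..n}" for i
      using b that by (simp add: B_def)
    \<comment> \<open>This keeps the raised entries within \<open>{1..n}\<close>.\<close>
    have "count_ge n b = 0" using bounds[of n] assms by simp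
    then have "\<forall>x\<in>set b. x < n" by (simp add: count_ge_eq_0_iff)
    then have cU: "c \<in> U" using b cb by (fastforce simp: B_def U_def)
    have "count_ge i c \<le> Suc n - i" if i: "i \<in> {1..n}" for i
    \<comment> \<open>The threshold 1 does not come from a threshold of \<open>b\<close> in the
      range; there the length of \<open>c\<close> suffices.\<close>
    proof (cases "i = 1")
      case True
      then show ?thesis
        using count_ge_le_length[of i c] cU by (simp add: U_def)
    next
      case False
      then obtain j where j: "i = Suc j" "j \<in> {1..n}" using i by (cases i) auto
      then show ?thesis using bounds[of j] by (simp add: cb count_ge_map_Suc)
    qed
    moreover have "\<forall>x\<in>set c. 2 \<le> x"
      using b cb by (auto simp: B_def U_def)
    ultimately show "c \<in> C" using cU by (simp add: C_def A_def)
  qed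
  then have "card C = card B"
    by (simp add: card_image inj_on_subset[OF inj_mapI[OF inj_Suc]])
  moreover have "finite C" using fin \<open>C \<subseteq> A\<close> finite_subset by blast
  ultimately show ?thesis
    using flaw park fin \<open>B \<subseteq> A\<close> \<open>C \<subseteq> A\<close> by (simp add: card_Diff_subset)
qed

end
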